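(* Let $\psi\in\mathbb{L}_n$ and $\psi^*\in\mathbb{L}_n$ (where $\psi^*$ is the convex conjugate of $\psi$), and let $b\in\mathcal{B}\subseteq \mathrm{dom}\,\psi^*$, where $\mathrm{int}(\mathrm{dom}\,\psi^* )=\mathrm{int}(B)$ and $\mathcal{B}\subseteq\mathrm{dom}\,\psi^*\subseteq B$ with $B=\mathrm{cl}(\mathrm{conv}\,\mathcal{B})$. Assume that $\mathrm{dom}\,\psi^*$ and $\mathrm{dom}\,\psi$ are open. Let $\sigma^2>0$ be a constant and let $p_0(b,\sigma^2)$ be a base measure satisfying $\int_{\mathcal{B}} p_\psi(b;\theta,\sigma^2)\,\nu(db)=1$, where $$p_\psi(b;\theta,\sigma^2)=\exp\!\left(-\frac{d_{\psi^*}(b;\theta)}{\sigma^2}\right)p_0(b,\sigma^2),\qquad d_{\psi^*}(b;\theta)=\psi^*(b)+\psi(\theta)-\langle b,\theta\rangle .$$ Then $p_\psi(b;\theta,\sigma^2)$ is a parameterized log-concave density function with the first cumulant $\nabla\psi(\theta)=\mathbf{E}[b]\in\mathrm{dom}\,\psi^*$ for all $\theta\in\mathrm{dom}\,\psi$. That is, $p_\psi(b;\theta,\sigma^2)$ is the $1$-LED model.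
   Context: Domains: for a lower semicontinuous, convex, proper $f$, $\mathrm{dom} f=\{x\in\mathbb{R}^n : f(x)<+\infty\}$ (effective domain); int, cl, bd, conv denote interior, closure, boundary and convex hull. The conjugate is $f^*(x)=\sup_t \langle x,t\rangle-f(t)$. Legendre functions: $\mathbb{L}_n$ is the class of lower semicontinuous, convex, proper functions $f:\mathrm{dom} f\subseteq\mathbb{R}^n\to\mathbb{R}$ such that (i) $\mathrm{int}(\mathrm{dom} f)\neq\emptyset$ and $f\in C^1(\mathrm{int}(\mathrm{dom} f))$; (ii) $f$ is strictly convex on $\mathrm{int}(\mathrm{dom} f)$; (iii) (steepness) for all $x\in\mathrm{bd}(\mathrm{dom} f)$ and $y\in\mathrm{int}(\mathrm{dom} f)$, $\lim_{t\downarrow0}\langle\nabla f(x+t(y-x)),y-x\rangle=-\infty$. Log-concave density function: $g(x)=\exp(-f(x))$ with $f\in\mathbb{L}_n$ and $\int_{\mathbb{R}^n}g(x)\,\nu(dx)=1$, where $\nu(dx)$ is an appropriate continuous Lebesgue (or discrete counting) measure. In the parameterized densities here, a base measure factor $p_0(b,\sigma^2)$, depending only on $b$ and $\sigma^2$ (not on $\theta$), is used together with $\nu$ to normalize. $\mathcal{B}\subseteq\mathbb{R}^n$ is the set of observations (values of the random vector $b$), and $\mathbf{E}[b]$ is the expectation of the observations $b$. K-LED (Legendre exponential dispersion model with $K$ cumulants, $K\ge1$): for $\psi\in\mathbb{L}_n\cap C^K(\mathrm{int}(\mathrm{dom}\,\psi))$ with $\nabla\psi(\theta)=\mathbf{E}[b]$,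 and $\mathcal{B}$ satisfying $\mathrm{int}(\mathrm{dom}\,\psi^* )=\mathrm{int}(B)$, $\mathcal{B}\subseteq\mathrm{dom}\,\psi^*\subseteq B$, it is the density $$p_\psi(b;\theta,\sigma^2)=\exp\!\left(\frac{\langle b,\theta\rangle-\psi(\theta)}{\sigma^2}\right)p_1(b,\sigma^2),$$ where $\sigma^2>0$ is a dispersion parameter, $\mathrm{dom}\,\psi$ is the canonical parameter space, $\mathrm{dom}\,\psi^*$ is the mean parameter space, and $p_1(b,\sigma^2)$ is a base measure satisfying $\int_{\mathcal{B}}p_\psi(b;\theta,\sigma^2)\,\nu(db)=1$. The function $K_\psi(x;\theta,\sigma^2)=\sigma^{-2}(\psi(\theta+x\sigma^2)-\psi(\theta))$ is its cumulant generating function up to the $K$-th cumulant (with $\theta+x\sigma^2\in\mathrm{dom}\,\psi$). The model is regular if $\mathrm{dom}\,\psi$ is open and non-regular otherwise. *)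

theory Defs
  imports "HOL-Analysis.Analysis"
begin

text \<open>
  A partial function \<open>f : dom f \<subseteq> R\<^sup>n \<rightarrow> R\<close> of convex analysis is modelled as an extended-real valued
  function on the whole space, with value \<open>\<infinity>\<close> off its effective domain.
\<close>

definition effdom :: "('a \<Rightarrow> ereal) \<Rightarrow> 'a set" where
  "effdom f = {x. f x < \<infinity>}"

text \<open>The finite values of \<open>f\<close>; meaningful on \<open>effdom f\<close> only, when \<open>f\<close> is proper.\<close>

definition fin :: "('a \<Rightarrow> ereal) \<Rightarrow> 'a \<Rightarrow> real" where
  "fin f x = real_of_ereal (f x)"

definition proper_fun :: "('a \<Rightarrow> ereal) \<Rightarrow> bool" where
  "proper_fun f \<longleftrightarrow> effdom f \<noteq> {} \<and> (\<forall>x. f x \<noteq> -\<infinity>)"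

definition lower_semicont :: "('a::euclidean_space \<Rightarrow> ereal) \<Rightarrow> bool" where
  "lower_semicont f \<longleftrightarrow> (\<forall>x. f x \<le> Liminf (at x) f)"

definition strictly_convex_on :: "'a::euclidean_space set \<Rightarrow> ('a \<Rightarrow> real) \<Rightarrow> bool" where
  "strictly_convex_on S f \<longleftrightarrow> convex S \<and>
     (\<forall>x\<in>S. \<forall>y\<in>S. \<forall>u>0. \<forall>v>0. x \<noteq> y \<and> u + v = 1 \<longrightarrow>
        f (u *\<^sub>R x + v *\<^sub>R y) < u * f x + v * f y)"

definition fenchel_conjugate :: "('a::euclidean_space \<Rightarrow> ereal) \<Rightarrow> 'a \<Rightarrow> ereal" where
  "fenchel_conjugate f x = (SUP t. ereal (x \<bullet> t) - f t)"

definition grad :: "('a::euclidean_space \<Rightarrow> real) \<Rightarrow> 'a \<Rightarrow> 'a" where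
  "grad f x = (THE D. GDERIV f x :> D)"

text \<open>Iterated partial derivative along a list of directions.\<close>

fun iter_partial :: "'a::euclidean_space list \<Rightarrow> ('a \<Rightarrow> real) \<Rightarrow> 'a \<Rightarrow> real" where
  "iter_partial [] f = f"
| "iter_partial (i # is) f = iter_partial is (\<lambda>x. frechet_derivative f (at x) i)"

text \<open>The class \<open>C\<^sup>K(S)\<close>, for open \<open>S\<close>.\<close>

definition Ck_on :: "nat \<Rightarrow> ('a::euclidean_space \<Rightarrow> real) \<Rightarrow> 'a set \<Rightarrow> bool" where
  "Ck_on K f S \<longleftrightarrow>
     (\<forall>is. set is \<subseteq> Basis \<and> length is \<le> K \<longrightarrow>
        continuous_on S (iter_partial is f) \<and>
        (length is < K \<longrightarrow> (\<forall>x\<in>S. iter_partial is f differentiable (at x))))"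

text \<open>The class \<open>L\<^sub>n\<close> of Legendre functions. In the presence of properness, convexity of the
  extended-real valued function is convexity of its finite part on the effective domain
  (\<open>convex_on\<close> includes convexity of that domain).\<close>

definition Legendre :: "('a::euclidean_space \<Rightarrow> ereal) \<Rightarrow> bool" where
  "Legendre f \<longleftrightarrow>
     lower_semicont f \<and> proper_fun f \<and> convex_on (effdom f) (fin f) \<and>
     interior (effdom f) \<noteq> {} \<and> Ck_on 1 (fin f) (interior (effdom f)) \<and>
     strictly_convex_on (interior (effdom f)) (fin f) \<and>
     (\<forall>x\<in>frontier (effdom f). \<forall>y\<in>interior (effdom f).
        filterlim (\<lambda>t. grad (fin f) (x + t *\<^sub>R (y - x)) \<bullet> (y - x)) at_bot (at_right 0))"

text \<open>\<open>exp(-u)\<close> for \<open>u\<close> in \<open>(-\<infinity>, \<infinity>]\<close>.\<close>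

definition exp_neg :: "ereal \<Rightarrow> real" where
  "exp_neg u = (if u = \<infinity> then 0 else exp (- real_of_ereal u))"

definition lebesgue_or_counting :: "'a::euclidean_space measure \<Rightarrow> bool" where
  "lebesgue_or_counting \<nu> \<longleftrightarrow> \<nu> = lebesgue \<or> \<nu> = count_space UNIV"

text \<open>The weight \<open>w\<close> is the density, with respect to \<open>\<nu>\<close>, of a base measure on the observation set \<open>B\<close>.\<close>

definition base_measure :: "'a measure \<Rightarrow> 'a set \<Rightarrow> ('a \<Rightarrow> real) \<Rightarrow> bool" where
  "base_measure \<nu> B w \<longleftrightarrow> (\<forall>b\<in>B. 0 \<le> w b) \<and> set_borel_measurable \<nu> B w"

text \<open>The random vector \<open>b\<close> with density \<open>q\<close> on \<open>B\<close> is integrable and \<open>E[b] = m\<close>.\<close>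

definition has_mean :: "'a::euclidean_space measure \<Rightarrow> 'a set \<Rightarrow> ('a \<Rightarrow> real) \<Rightarrow> 'a \<Rightarrow> bool" where
  "has_mean \<nu> B q m \<longleftrightarrow>
     set_integrable \<nu> B (\<lambda>b. q b *\<^sub>R b) \<and> (LINT b:B|\<nu>. q b *\<^sub>R b) = m"

text \<open>The cumulant generating function of the density \<open>q\<close> on \<open>B\<close>; the cumulants are its partial
  derivatives at \<open>0\<close>, so only its values near \<open>0\<close> matter.\<close>

definition cgf :: "'a::euclidean_space measure \<Rightarrow> 'a set \<Rightarrow> ('a \<Rightarrow> real) \<Rightarrow> 'a \<Rightarrow> real" where
  "cgf \<nu> B q x = ln (LINT b:B|\<nu>. exp (x \<bullet> b) * q b)"

definition K_fun :: "('a::euclidean_space \<Rightarrow> ereal) \<Rightarrow> 'a \<Rightarrow> real \<Rightarrow> 'a \<Rightarrow> real" where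
  "K_fun \<psi> \<theta> \<sigma>2 x = (fin \<psi> (\<theta> + \<sigma>2 *\<^sub>R x) - fin \<psi> \<theta>) / \<sigma>2"

text \<open>A family \<open>p b \<theta> \<sigma>2\<close>, \<open>\<theta> \<in> T\<close>, of log-concave densities on \<open>B\<close>: up to the base factor \<open>p0\<close>, which
  does not depend on \<open>\<theta>\<close> and normalizes together with \<open>\<nu>\<close>, each member is \<open>exp(-f)\<close> with \<open>f\<close> Legendre.\<close>

definition parameterized_log_concave_density ::
  "'a::euclidean_space measure \<Rightarrow> 'a set \<Rightarrow> ('a \<Rightarrow> real \<Rightarrow> real) \<Rightarrow> 'a set \<Rightarrow> real
   \<Rightarrow> ('a \<Rightarrow> 'a \<Rightarrow> real \<Rightarrow> real) \<Rightarrow> bool" where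
  "parameterized_log_concave_density \<nu> B p0 T \<sigma>2 p \<longleftrightarrow>
     base_measure \<nu> B (\<lambda>b. p0 b \<sigma>2) \<and>
     (\<forall>\<theta>\<in>T. (\<exists>f. Legendre f \<and> (\<forall>b. p b \<theta> \<sigma>2 = exp_neg (f b) * p0 b \<sigma>2)) \<and>
             (LINT b:B|\<nu>. p b \<theta> \<sigma>2) = 1)"

text \<open>The relations between the observation set \<open>B\<close>, the closed convex hull of \<open>B\<close> and the mean
  parameter space.\<close>

definition observation_set :: "('a::euclidean_space \<Rightarrow> ereal) \<Rightarrow> 'a set \<Rightarrow> bool" where
  "observation_set \<psi> B \<longleftrightarrow>
     interior (effdom (fenchel_conjugate \<psi>)) = interior (closure (convex hull B)) \<and>
     B \<subseteq> effdom (fenchel_conjugate \<psi>) \<and>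
     effdom (fenchel_conjugate \<psi>) \<subseteq> closure (convex hull B)"

text \<open>The Legendre exponential dispersion model with \<open>K\<close> cumulants. The last conjunct says that
  \<open>K_fun \<psi> \<theta> \<sigma>2\<close> is the cumulant generating function up to the \<open>K\<close>-th cumulant. The gradient of
  \<open>\<psi>\<close> only makes sense in the interior of the canonical parameter space, which need not be open.\<close>

definition K_LED ::
  "nat \<Rightarrow> 'a::euclidean_space measure \<Rightarrow> 'a set \<Rightarrow> ('a \<Rightarrow> ereal) \<Rightarrow> real
   \<Rightarrow> ('a \<Rightarrow> 'a \<Rightarrow> real \<Rightarrow> real) \<Rightarrow> bool" where
  "K_LED K \<nu> B \<psi> \<sigma>2 p \<longleftrightarrow>
     1 \<le> K \<and> 0 < \<sigma>2 \<and>
     Legendre \<psi> \<and> Ck_on K (fin \<psi>) (interior (effdom \<psi>)) \<and>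
     observation_set \<psi> B \<and>
     (\<exists>p1 :: 'a \<Rightarrow> real \<Rightarrow> real. base_measure \<nu> B (\<lambda>b. p1 b \<sigma>2) \<and>
        (\<forall>\<theta>\<in>effdom \<psi>. \<forall>b\<in>B. p b \<theta> \<sigma>2 = exp ((b \<bullet> \<theta> - fin \<psi> \<theta>) / \<sigma>2) * p1 b \<sigma>2)) \<and>
     (\<forall>\<theta>\<in>effdom \<psi>. (LINT b:B|\<nu>. p b \<theta> \<sigma>2) = 1) \<and>
     (\<forall>\<theta>\<in>interior (effdom \<psi>). has_mean \<nu> B (\<lambda>b. p b \<theta> \<sigma>2) (grad (fin \<psi>) \<theta>)) \<and>
     (\<forall>\<theta>\<in>interior (effdom \<psi>). \<forall>is. set is \<subseteq> Basis \<and> length is \<le> K \<longrightarrow>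
        iter_partial is (cgf \<nu> B (\<lambda>b. p b \<theta> \<sigma>2)) 0 = iter_partial is (K_fun \<psi> \<theta> \<sigma>2) 0)"

definition divergence :: "('a::euclidean_space \<Rightarrow> ereal) \<Rightarrow> 'a \<Rightarrow> 'a \<Rightarrow> ereal" where
  "divergence \<psi> b \<theta> = fenchel_conjugate \<psi> b + \<psi> \<theta> - ereal (b \<bullet> \<theta>)"

definition p_dens ::
  "('a::euclidean_space \<Rightarrow> ereal) \<Rightarrow> ('a \<Rightarrow> real \<Rightarrow> real) \<Rightarrow> 'a \<Rightarrow> 'a \<Rightarrow> real \<Rightarrow> real" where
  "p_dens \<psi> p0 b \<theta> \<sigma>2 = exp_neg (divergence \<psi> b \<theta> / ereal \<sigma>2) * p0 b \<sigma>2"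

end

theory Submission
  imports Defs
begin

text \<open>
  Set \<open>p\<^sub>1(b) = exp (- \<psi>\<^sup>*(b) / \<sigma>\<^sup>2) p\<^sub>0(b)\<close>. On the observation set the density is then
  \<open>exp ((\<langle>b,\<theta>\<rangle> - \<psi>(\<theta>)) / \<sigma>\<^sup>2) p\<^sub>1(b)\<close> (\<open>p_dens_eq\<close>), an exponential family in \<open>\<theta>\<close>. Tilting the member at
  \<open>\<theta>\<close> by \<open>exp \<langle>x,b\<rangle>\<close> gives, up to the constant \<open>exp K(x)\<close> with
  \<open>K(x) = (\<psi>(\<theta> + \<sigma>\<^sup>2 x) - \<psi>(\<theta>)) / \<sigma>\<^sup>2\<close>, the member at \<open>\<theta> + \<sigma>\<^sup>2 x\<close>. Since every member has mass one
  and the parameter space is open, the moment generating function at \<open>\<theta>\<close> is \<open>exp K(x)\<close> for all small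
  \<open>x\<close> (\<open>mgf_p_dens\<close>). The cumulant generating function therefore agrees with \<open>K\<close> near \<open>0\<close> and its gradient
  there is \<open>\<nabla>\<psi>(\<theta>)\<close>.

  That this gradient is the expectation follows without differentiating under the integral sign: from
  \<open>exp t \<ge> 1 + t\<close> the moment generating function lies above the affine function whose slope is the
  mean, with contact at \<open>0\<close>, so differentiability at \<open>0\<close> forces the two slopes to agree
  (\<open>has_mean_of_mgf_GDERIV\<close>).

  Two facts of convex analysis complete the proof. The gradient lies in \<open>dom \<psi>\<^sup>*\<close> because the tangent
  inequality bounds the supremum that defines \<open>\<psi>\<^sup>*(\<nabla>\<psi>(\<theta>))\<close>
  (\<open>Legendre_grad_in_effdom_conjugate\<close>). Log-concavity holds because, for fixed \<open>\<theta>\<close>, the exponent is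
  \<open>\<psi>\<^sup>*\<close> plus an affine function, divided by \<open>\<sigma>\<^sup>2\<close>, and such perturbations preserve the Legendre
  property (\<open>Legendre_tilt\<close>).
\<close>

section \<open>Gradients of Legendre functions\<close>

lemma GDERIV_unique:
  assumes "GDERIV f x :> D" "GDERIV f x :> E"
  shows "D = E"
proof -
  have "(\<lambda>h. h \<bullet> D) = (\<lambda>h. h \<bullet> E)"
    using assms unfolding gderiv_def by (rule has_derivative_unique)
  then show ?thesis
    by (metis vector_eq_ldot)
qed

lemma grad_eqI: "GDERIV f x :> D \<Longrightarrow> grad f x = D"
  unfolding grad_def by (rule the_equality) (auto intro: GDERIV_unique)

lemma GDERIV_along_line:
  assumes "GDERIV f x :> D"
  shows "((\<lambda>t. f (x + t *\<^sub>R u)) has_field_derivative u \<bullet> D) (at 0)"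
proof -
  have "(f has_derivative (\<lambda>h. h \<bullet> D)) (at (x + 0 *\<^sub>R u))"
    using assms unfolding gderiv_def by simp
  moreover have "((\<lambda>t. x + t *\<^sub>R u) has_derivative (\<lambda>t. t *\<^sub>R u)) (at 0)"
    by (auto intro!: derivative_eq_intros)
  ultimately have "((\<lambda>t. f (x + t *\<^sub>R u)) has_derivative (\<lambda>t. (t *\<^sub>R u) \<bullet> D)) (at 0)"
    using has_derivative_compose by blast
  then show ?thesis
    unfolding has_field_derivative_def by (rule has_derivative_eq_rhs) (auto simp: mult.commute)
qed

text \<open>Every linear functional on a Euclidean space is an inner product with a vector, so a differentiable
  function has a gradient and the definite description in \<open>grad\<close> denotes it.\<close>

lemma differentiable_imp_GDERIV_grad:
  fixes f :: "'a::euclidean_space \<Rightarrow> real"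
  assumes "f differentiable (at x)"
  shows "GDERIV f x :> grad f x"
proof -
  obtain f' where f': "(f has_derivative f') (at x)"
    using assms unfolding differentiable_def by blast
  interpret linear f' using f' by (rule has_derivative_linear)
  have "f' = (\<lambda>h. h \<bullet> (\<Sum>i\<in>Basis. f' i *\<^sub>R i))"
  proof
    fix h
    have "f' h = f' (\<Sum>i\<in>Basis. (h \<bullet> i) *\<^sub>R i)" by (simp add: euclidean_representation)
    also have "\<dots> = h \<bullet> (\<Sum>i\<in>Basis. f' i *\<^sub>R i)"
      by (simp add: sum scaleR inner_sum_right mult.commute)
    finally show "f' h = h \<bullet> (\<Sum>i\<in>Basis. f' i *\<^sub>R i)" .
  qed
  with f' have "GDERIV f x :> (\<Sum>i\<in>Basis. f' i *\<^sub>R i)" unfolding gderiv_def by simp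
  then show ?thesis using grad_eqI by metis
qed

lemma Ck_on_1_differentiable:
  assumes "Ck_on 1 f S" "x \<in> S"
  shows "f differentiable (at x)"
  using assms unfolding Ck_on_def by (auto dest!: spec[of _ "[]"])

lemma Legendre_GDERIV:
  assumes "Legendre f" "x \<in> interior (effdom f)"
  shows "GDERIV (fin f) x :> grad (fin f) x"
  using assms differentiable_imp_GDERIV_grad Ck_on_1_differentiable
  unfolding Legendre_def by blast

text \<open>The gap between the chord from \<open>x\<close> to \<open>y\<close> and the graph of \<open>f\<close> is nonnegative and vanishes at \<open>x\<close>,
  so its derivative at \<open>x\<close> in the direction of \<open>y\<close> cannot be negative.\<close>

lemma convex_on_above_tangent_GDERIV:
  fixes f :: "'a::euclidean_space \<Rightarrow> real"
  assumes conv: "convex_on S f" and x: "x \<in> S" and y: "y \<in> S" and g: "GDERIV f x :> g"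
  shows "f x + (y - x) \<bullet> g \<le> f y"
proof (rule ccontr)
  assume "\<not> ?thesis"
  then have neg: "f y - f x - (y - x) \<bullet> g < 0" by simp
  define \<phi> where "\<phi> t = (1 - t) * f x + t * f y - f (x + t *\<^sub>R (y - x))" for t
  have "((\<lambda>t. f (x + t *\<^sub>R (y - x))) has_field_derivative (y - x) \<bullet> g) (at 0)"
    using g by (rule GDERIV_along_line)
  then have "(\<phi> has_field_derivative (f y - f x - (y - x) \<bullet> g)) (at 0)"
    unfolding \<phi>_def by (auto intro!: derivative_eq_intros)
  from DERIV_neg_dec_right[OF this neg]
  obtain d where d: "0 < d" "\<And>h. 0 < h \<Longrightarrow> h < d \<Longrightarrow> \<phi> h < \<phi> 0" by auto
  define h where "h = min 1 (d / 2)"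
  have h: "0 < h" "h < d" "h \<le> 1" using d(1) by (auto simp: h_def min_def)
  have "f ((1 - h) *\<^sub>R x + h *\<^sub>R y) \<le> (1 - h) * f x + h * f y"
    using convex_onD[OF conv, of h x y] h x y by simp
  moreover have "(1 - h) *\<^sub>R x + h *\<^sub>R y = x + h *\<^sub>R (y - x)"
    by (simp add: algebra_simps)
  ultimately have "0 \<le> \<phi> h" unfolding \<phi>_def by simp
  moreover have "\<phi> 0 = 0" by (simp add: \<phi>_def)
  ultimately show False using d(2)[OF h(1,2)] by simp
qed

lemma proper_fun_eq_ereal_fin:
  assumes "proper_fun f" "x \<in> effdom f"
  shows "f x = ereal (fin f x)"
  using assms unfolding proper_fun_def effdom_def fin_def
  by (cases "f x") (auto dest: spec[of _ x])

text \<open>By the tangent inequality, \<open>\<langle>g,t\<rangle> - f(t)\<close> with \<open>g = \<nabla>f(x)\<close> is largest at \<open>t = x\<close>, where it is finite.\<close>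

lemma Legendre_grad_in_effdom_conjugate:
  assumes L: "Legendre f" and x: "x \<in> interior (effdom f)"
  shows "grad (fin f) x \<in> effdom (fenchel_conjugate f)"
proof -
  let ?g = "grad (fin f) x"
  have p: "proper_fun f" and c: "convex_on (effdom f) (fin f)" using L by (auto simp: Legendre_def)
  have xs: "x \<in> effdom f" using x interior_subset by blast
  have "ereal (?g \<bullet> t) - f t \<le> ereal (?g \<bullet> x - fin f x)" for t
  proof (cases "t \<in> effdom f")
    case True
    have "fin f x + (t - x) \<bullet> ?g \<le> fin f t"
      by (rule convex_on_above_tangent_GDERIV[OF c xs True Legendre_GDERIV[OF L x]])
    then show ?thesis
      by (simp add: proper_fun_eq_ereal_fin[OF p True] inner_diff_left inner_commute)
  next
    case False
    then have "f t = \<infinity>" by (simp add: effdom_def)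
    then show ?thesis by simp
  qed
  then have "fenchel_conjugate f ?g \<le> ereal (?g \<bullet> x - fin f x)"
    unfolding fenchel_conjugate_def by (intro SUP_least)
  then show ?thesis unfolding effdom_def using order_le_less_trans by fastforce
qed

section \<open>Affine perturbations of Legendre functions\<close>

context
  fixes g :: "'a::euclidean_space \<Rightarrow> ereal" and a c :: real and \<theta> :: 'a and f
  assumes L: "Legendre g" and c: "0 < c"
  defines "f \<equiv> \<lambda>b. (g b + ereal a - ereal (b \<bullet> \<theta>)) / ereal c"
begin

lemma proper_g: "proper_fun g"
  using L by (simp add: Legendre_def)

lemma tilt_finite: "b \<in> effdom g \<Longrightarrow> f b = ereal ((fin g b + a - b \<bullet> \<theta>) / c)"
  using proper_fun_eq_ereal_fin[OF proper_g] c by (simp add: f_def)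

lemma tilt_infinite: "b \<notin> effdom g \<Longrightarrow> f b = \<infinity>"
  using c by (simp add: f_def effdom_def)

lemma effdom_tilt: "effdom f = effdom g"
proof (intro set_eqI iffI)
  fix x
  show "x \<in> effdom g" if "x \<in> effdom f"
    using that tilt_infinite[of x] by (auto simp: effdom_def[of f])
  show "x \<in> effdom f" if "x \<in> effdom g"
    using tilt_finite[OF that] by (simp add: effdom_def[of f])
qed

lemma fin_tilt: "b \<in> effdom g \<Longrightarrow> fin f b = (fin g b + a - b \<bullet> \<theta>) / c"
  by (simp add: fin_def[of f] tilt_finite)

lemma proper_tilt: "proper_fun f"
  unfolding proper_fun_def effdom_tilt
proof
  show "effdom g \<noteq> {}" using proper_g by (simp add: proper_fun_def)
  show "\<forall>x. f x \<noteq> -\<infinity>"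
  proof
    fix x show "f x \<noteq> -\<infinity>"
      by (cases "x \<in> effdom g") (simp_all add: tilt_finite tilt_infinite)
  qed
qed

text \<open>A value \<open>r\<close> below \<open>f x\<close> translates into the bound \<open>r c - a + \<langle>x,\<theta>\<rangle> < g x\<close>. A real \<open>s\<close> strictly between
  the two sides separates the variations of \<open>g\<close>, which is only semicontinuous, from those of the
  continuous affine part.\<close>

lemma lower_semicont_tilt: "lower_semicont f"
  unfolding lower_semicont_def le_Liminf_iff
proof (intro allI impI)
  fix x y assume y: "y < f x"
  then obtain r where r: "y < ereal r" "ereal r < f x" using ereal_dense2 by blast
  have "ereal (r * c - a + x \<bullet> \<theta>) < g x"
  proof (cases "x \<in> effdom g")
    case True
    then show ?thesis
      using r(2) c by (simp add: tilt_finite proper_fun_eq_ereal_fin[OF proper_g True] field_simps)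
  next
    case False then show ?thesis by (simp add: effdom_def)
  qed
  then obtain s where s: "r * c - a + x \<bullet> \<theta> < s" "ereal s < g x"
    using ereal_dense2 by (metis less_ereal.simps(1))
  have "\<forall>\<^sub>F z in at x. ereal s < g z"
    using L s(2) unfolding Legendre_def lower_semicont_def le_Liminf_iff by blast
  moreover have "((\<lambda>z. r * c - a + z \<bullet> \<theta>) \<longlongrightarrow> r * c - a + x \<bullet> \<theta>) (at x)"
    by (intro tendsto_intros)
  then have "\<forall>\<^sub>F z in at x. r * c - a + z \<bullet> \<theta> < s"
    using s(1) by (rule order_tendstoD)
  ultimately show "\<forall>\<^sub>F z in at x. y < f z"
  proof eventually_elim
    case (elim z)
    show ?case
    proof (cases "z \<in> effdom g")
      case True
      have "r * c - a + z \<bullet> \<theta> < fin g z"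
        using elim proper_fun_eq_ereal_fin[OF proper_g True] by simp
      then have "ereal r < f z" using c by (simp add: tilt_finite[OF True] field_simps)
      then show ?thesis using r(1) by simp
    next
      case False then show ?thesis using r(1) by (auto simp: tilt_infinite)
    qed
  qed
qed

lemma convex_on_tilt: "convex_on (effdom g) (fin f)"
proof -
  have cg: "convex_on (effdom g) (fin g)" using L by (simp add: Legendre_def)
  show ?thesis
  proof (rule convex_onI)
    show C: "convex (effdom g)" using cg by (rule convex_on_imp_convex)
    fix t :: real and x y assume t: "0 < t" "t < 1" and x: "x \<in> effdom g" and y: "y \<in> effdom g"
    have z: "(1 - t) *\<^sub>R x + t *\<^sub>R y \<in> effdom g" using convexD_alt[OF C x y] t by simp
    have "fin g ((1 - t) *\<^sub>R x + t *\<^sub>R y) \<le> (1 - t) * fin g x + t * fin g y"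
      using convex_onD[OF cg, of t x y] t x y by simp
    then show "fin f ((1 - t) *\<^sub>R x + t *\<^sub>R y) \<le> (1 - t) * fin f x + t * fin f y"
      using c by (simp add: fin_tilt x y z inner_add_left divide_simps) (simp add: algebra_simps)
  qed
qed

lemma strictly_convex_on_tilt: "strictly_convex_on (interior (effdom g)) (fin f)"
proof -
  have sg: "strictly_convex_on (interior (effdom g)) (fin g)" using L by (simp add: Legendre_def)
  then have C: "convex (interior (effdom g))" by (simp add: strictly_convex_on_def)
  show ?thesis unfolding strictly_convex_on_def
  proof (intro conjI ballI allI impI C)
    fix x y and u v :: real
    assume x: "x \<in> interior (effdom g)" and y: "y \<in> interior (effdom g)"
      and u: "0 < u" and v: "0 < v" and xy: "x \<noteq> y \<and> u + v = 1"
    have ds: "x \<in> effdom g" "y \<in> effdom g" "u *\<^sub>R x + v *\<^sub>R y \<in> effdom g"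
      using x y convexD[OF C x y, of u v] u v xy interior_subset by auto
    have "fin g (u *\<^sub>R x + v *\<^sub>R y) < u * fin g x + v * fin g y"
      using sg x y u v xy unfolding strictly_convex_on_def by blast
    moreover have "a = u * a + v * a" using xy by (metis distrib_right mult_1)
    ultimately show "fin f (u *\<^sub>R x + v *\<^sub>R y) < u * fin f x + v * fin f y"
      using c by (simp add: fin_tilt ds inner_add_left divide_simps) (simp add: algebra_simps)
  qed
qed

lemma GDERIV_tilt:
  assumes x: "x \<in> interior (effdom g)"
  shows "GDERIV (fin f) x :> (grad (fin g) x - \<theta>) /\<^sub>R c"
proof -
  have "(fin g has_derivative (\<lambda>h. h \<bullet> grad (fin g) x)) (at x)"
    using Legendre_GDERIV[OF L x] by (simp add: gderiv_def)
  then have "((\<lambda>b. (fin g b + a - b \<bullet> \<theta>) / c) has_derivative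
      (\<lambda>h. (h \<bullet> grad (fin g) x - h \<bullet> \<theta>) / c)) (at x)"
    using c by (auto intro!: derivative_eq_intros)
  then have "(fin f has_derivative (\<lambda>h. (h \<bullet> grad (fin g) x - h \<bullet> \<theta>) / c)) (at x)"
    by (rule has_derivative_transform_within_open[OF _ open_interior x])
       (simp add: fin_tilt interior_subset[THEN subsetD])
  then show ?thesis
    by (simp add: gderiv_def inner_diff_right divide_inverse mult.commute)
qed

lemma Ck_on_tilt: "Ck_on 1 (fin f) (interior (effdom g))"
  unfolding Ck_on_def
proof (intro allI impI conjI ballI)
  let ?S = "interior (effdom g)"
  have frechet: "frechet_derivative h (at x) i = i \<bullet> D" if "GDERIV h x :> D" for h :: "'a \<Rightarrow> real" and x D i
    using frechet_derivative_at[OF that[unfolded gderiv_def]] by metis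
  have diff: "fin f differentiable (at x)" if "x \<in> ?S" for x
    using GDERIV_tilt[OF that] unfolding gderiv_def differentiable_def by blast
  fix "is" :: "'a list" assume is01: "set is \<subseteq> Basis \<and> length is \<le> 1"
  show "continuous_on ?S (iter_partial is (fin f))"
  proof (cases "is")
    case Nil
    have "continuous_on ?S (fin f)"
      using diff by (meson differentiable_at_withinI differentiable_imp_continuous_on differentiable_on_def)
    then show ?thesis using Nil by simp
  next
    case (Cons i js)
    with is01 have Nil: "js = []" by auto
    have "Ck_on 1 (fin g) ?S" using L by (simp add: Legendre_def)
    then have "continuous_on ?S (iter_partial [i] (fin g))"
      using is01 unfolding Ck_on_def Cons Nil by blast
    then have "continuous_on ?S (\<lambda>x. frechet_derivative (fin g) (at x) i)" by simp
    then have "continuous_on ?S (\<lambda>x. (frechet_derivative (fin g) (at x) i - i \<bullet> \<theta>) / c)"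
      using c by (auto intro!: continuous_intros)
    moreover have "(frechet_derivative (fin g) (at x) i - i \<bullet> \<theta>) / c = frechet_derivative (fin f) (at x) i"
      if "x \<in> ?S" for x
      using frechet[OF Legendre_GDERIV[OF L that]] frechet[OF GDERIV_tilt[OF that]]
      by (simp add: inner_diff_right divide_inverse mult.commute)
    ultimately show ?thesis using Cons Nil by (simp cong: continuous_on_cong)
  qed
  fix x assume "length is < 1" "x \<in> ?S"
  then show "iter_partial is (fin f) differentiable (at x)" using diff by simp
qed

text \<open>Along the segment the affine part only contributes the constant \<open>- \<langle>\<theta>,y - x\<rangle>\<close>. The gradient formula
  applies because, by convexity, the segment from a frontier point to an interior point immediately
  enters the interior.\<close>

lemma steep_tilt:
  assumes x: "x \<in> frontier (effdom g)" and y: "y \<in> interior (effdom g)"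
  shows "filterlim (\<lambda>t. grad (fin f) (x + t *\<^sub>R (y - x)) \<bullet> (y - x)) at_bot (at_right 0)"
proof -
  let ?z = "\<lambda>t. x + t *\<^sub>R (y - x)"
  have C: "convex (effdom g)" using L convex_on_imp_convex by (auto simp: Legendre_def)
  have lim: "filterlim (\<lambda>t. grad (fin g) (?z t) \<bullet> (y - x)) at_bot (at_right 0)"
    using L x y unfolding Legendre_def by blast
  have "LIM t at_right 0. - (\<theta> \<bullet> (y - x)) + grad (fin g) (?z t) \<bullet> (y - x) :> at_bot"
    using lim by (subst filterlim_tendsto_add_at_bot_iff[OF tendsto_const])
  then have "LIM t at_right 0. inverse c * (- (\<theta> \<bullet> (y - x)) + grad (fin g) (?z t) \<bullet> (y - x)) :> at_bot"
    using c by (intro filterlim_tendsto_pos_mult_at_bot[OF tendsto_const]) auto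
  moreover have "\<forall>\<^sub>F t in at_right 0. inverse c * (- (\<theta> \<bullet> (y - x)) + grad (fin g) (?z t) \<bullet> (y - x))
      = grad (fin f) (?z t) \<bullet> (y - x)"
    unfolding eventually_at_right_field
  proof (intro exI[of _ 1] conjI allI impI)
    fix t :: real assume t: "0 < t" "t < 1"
    have "x - t *\<^sub>R (x - y) \<in> interior (effdom g)"
      using mem_interior_closure_convex_shrink[OF C y, of x t] x t by (auto simp: frontier_def)
    then have "?z t \<in> interior (effdom g)" by (simp add: algebra_simps)
    from grad_eqI[OF GDERIV_tilt[OF this]]
    show "inverse c * (- (\<theta> \<bullet> (y - x)) + grad (fin g) (?z t) \<bullet> (y - x)) = grad (fin f) (?z t) \<bullet> (y - x)"
      by (simp add: inner_diff_left)
  qed simp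
  ultimately show ?thesis by (rule filterlim_cong[OF refl refl, THEN iffD1, rotated])
qed

lemma Legendre_tilt: "Legendre f"
  using L lower_semicont_tilt proper_tilt convex_on_tilt strictly_convex_on_tilt Ck_on_tilt steep_tilt
  unfolding Legendre_def effdom_tilt by blast

end

section \<open>Means from moment generating functions\<close>

text \<open>Integrability of each coordinate comes from \<open>\<bar>s\<bar> \<le> exp s + exp (- s)\<close>. Its integral is then the
  slope of a supporting line at \<open>0\<close> of the moment generating function along that coordinate, hence its
  derivative.\<close>

lemma has_mean_of_mgf_GDERIV:
  fixes \<nu> :: "'a::euclidean_space measure"
  assumes id[measurable]: "(\<lambda>b. b) \<in> borel_measurable \<nu>"
    and q: "\<And>b. b \<in> B \<Longrightarrow> 0 \<le> q b"
    and d: "0 < d"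
    and int: "\<And>x. norm x < d \<Longrightarrow> set_integrable \<nu> B (\<lambda>b. exp (x \<bullet> b) * q b)"
    and der: "GDERIV (\<lambda>x. LINT b:B|\<nu>. exp (x \<bullet> b) * q b) 0 :> m"
  shows "has_mean \<nu> B q m"
proof -
  define M where "M x = (LINT b:B|\<nu>. exp (x \<bullet> b) * q b)" for x
  have q0: "set_integrable \<nu> B q" using int[of 0] d by simp
  have qm[measurable]: "(\<lambda>b. indicator B b *\<^sub>R q b) \<in> borel_measurable \<nu>"
    using q0 unfolding set_integrable_def by (rule borel_measurable_integrable)
  have comp: "set_integrable \<nu> B (\<lambda>b. q b * (b \<bullet> u)) \<and> (LINT b:B|\<nu>. q b * (b \<bullet> u)) = m \<bullet> u"
    if u: "u \<in> Basis" for u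
  proof
    define t where "t = d / 2"
    have t: "0 < t" "t < d" using d by (auto simp: t_def)
    have small: "norm (s *\<^sub>R u) = \<bar>s\<bar>" for s using u by simp
    have "norm (t *\<^sub>R u) < d" "norm ((- t) *\<^sub>R u) < d" unfolding small using t by auto
    then have "set_integrable \<nu> B (\<lambda>b. inverse t * (exp ((t *\<^sub>R u) \<bullet> b) * q b + exp (((-t) *\<^sub>R u) \<bullet> b) * q b))"
      by (intro set_integrable_mult_right set_integral_add int)
    then show ui: "set_integrable \<nu> B (\<lambda>b. q b * (b \<bullet> u))"
    proof (rule set_integrable_bound)
      have "(\<lambda>b. (indicator B b *\<^sub>R q b) * (b \<bullet> u)) \<in> borel_measurable \<nu>" by measurable
      then show "set_borel_measurable \<nu> B (\<lambda>b. q b * (b \<bullet> u))"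
        unfolding set_borel_measurable_def by (simp add: mult.assoc)
      have "norm (q b * (b \<bullet> u)) \<le>
          norm (inverse t * (exp ((t *\<^sub>R u) \<bullet> b) * q b + exp (((-t) *\<^sub>R u) \<bullet> b) * q b))"
        if b: "b \<in> B" for b
      proof -
        have "t * \<bar>b \<bullet> u\<bar> \<le> exp (t * (b \<bullet> u)) + exp (- (t * (b \<bullet> u)))"
        proof -
          have "\<bar>s\<bar> \<le> exp s + exp (- s)" for s :: real
            using exp_ge_add_one_self[of s] exp_ge_add_one_self[of "-s"] exp_gt_zero[of s] exp_gt_zero[of "-s"]
            by linarith
          from this[of "t * (b \<bullet> u)"] show ?thesis using t by (simp add: abs_mult)
        qed
        then have "\<bar>b \<bullet> u\<bar> \<le> inverse t * (exp (t * (b \<bullet> u)) + exp (- (t * (b \<bullet> u))))"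
          using t by (simp add: field_simps)
        then have "q b * \<bar>b \<bullet> u\<bar> \<le> q b * (inverse t * (exp (t * (b \<bullet> u)) + exp (- (t * (b \<bullet> u)))))"
          using q[OF b] by (rule mult_left_mono)
        also have "\<dots> = inverse t * (exp ((t *\<^sub>R u) \<bullet> b) * q b + exp (((-t) *\<^sub>R u) \<bullet> b) * q b)"
          by (simp add: inner_commute algebra_simps)
        finally show ?thesis using q[OF b] t(1) by (simp add: abs_mult)
      qed
      then show "AE b in \<nu>. b \<in> B \<longrightarrow> norm (q b * (b \<bullet> u)) \<le>
          norm (inverse t * (exp ((t *\<^sub>R u) \<bullet> b) * q b + exp (((-t) *\<^sub>R u) \<bullet> b) * q b))"
        by blast
    qed
    let ?m = "LINT b:B|\<nu>. q b * (b \<bullet> u)"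
    \<comment> \<open>The gap between the moment generating function and its supporting line, up to the constant \<open>M 0\<close>;
      it is minimal at \<open>0\<close>.\<close>
    define \<phi> where "\<phi> s = M (s *\<^sub>R u) - s * ?m" for s
    have "((\<lambda>s. M (s *\<^sub>R u)) has_field_derivative (u \<bullet> m)) (at 0)"
      using GDERIV_along_line[OF der, of u] by (simp add: M_def)
    then have der0: "(\<phi> has_field_derivative (u \<bullet> m - ?m)) (at 0)"
      unfolding \<phi>_def by (auto intro!: derivative_eq_intros)
    have "\<phi> 0 \<le> \<phi> s" if s: "\<bar>0 - s\<bar> < d" for s
    proof -
      have "(LINT b:B|\<nu>. q b + s * (q b * (b \<bullet> u))) \<le> M (s *\<^sub>R u)"
        unfolding M_def
      proof (rule set_integral_mono)
        show "set_integrable \<nu> B (\<lambda>b. q b + s * (q b * (b \<bullet> u)))"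
          using q0 ui by simp
        show "set_integrable \<nu> B (\<lambda>b. exp ((s *\<^sub>R u) \<bullet> b) * q b)"
          by (rule int) (use s u in simp)
        fix b assume b: "b \<in> B"
        have "(1 + s * (b \<bullet> u)) * q b \<le> exp (s * (b \<bullet> u)) * q b"
          using exp_ge_add_one_self q[OF b] by (intro mult_right_mono)
        then show "q b + s * (q b * (b \<bullet> u)) \<le> exp ((s *\<^sub>R u) \<bullet> b) * q b"
          by (simp add: inner_commute algebra_simps)
      qed
      also have "(LINT b:B|\<nu>. q b + s * (q b * (b \<bullet> u))) = M 0 + s * ?m"
        using q0 ui by (simp add: M_def)
      finally show ?thesis by (simp add: \<phi>_def)
    qed
    then have "u \<bullet> m - ?m = 0" using DERIV_local_min[OF der0 d] by blast
    then show "?m = m \<bullet> u" by (simp add: inner_commute)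
  qed
  have "set_integrable \<nu> B (\<lambda>b. (q b * (b \<bullet> u)) *\<^sub>R u)" if "u \<in> Basis" for u
    using comp[OF that] by (intro set_integrable_scaleR_left) simp
  then have "set_integrable \<nu> B (\<lambda>b. \<Sum>u\<in>Basis. (q b * (b \<bullet> u)) *\<^sub>R u)"
    unfolding set_integrable_def scaleR_sum_right by (rule Bochner_Integration.integrable_sum)
  moreover have rep: "(\<Sum>u\<in>Basis. (q b * (b \<bullet> u)) *\<^sub>R u) = q b *\<^sub>R b" for b
    by (simp add: euclidean_representation flip: scaleR_scaleR scaleR_sum_right)
  ultimately have I: "set_integrable \<nu> B (\<lambda>b. q b *\<^sub>R b)" by simp
  have "(LINT b:B|\<nu>. q b *\<^sub>R b) \<bullet> u = m \<bullet> u" if u: "u \<in> Basis" for u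
  proof -
    have "(LINT b:B|\<nu>. q b *\<^sub>R b) \<bullet> u = (LINT b:B|\<nu>. q b * (b \<bullet> u))"
      using integral_inner_left[of u \<nu> "\<lambda>b. indicator B b *\<^sub>R (q b *\<^sub>R b)"] I
      unfolding set_lebesgue_integral_def set_integrable_def by (simp add: mult.assoc)
    then show ?thesis using comp[OF u] by simp
  qed
  then have "(LINT b:B|\<nu>. q b *\<^sub>R b) = m" by (rule euclidean_eqI)
  with I show ?thesis unfolding has_mean_def by simp
qed

section \<open>The exponential family of a Legendre function\<close>

context
  fixes \<psi> :: "'a::euclidean_space \<Rightarrow> ereal" and B :: "'a set" and \<nu> :: "'a measure"
    and p0 :: "'a \<Rightarrow> real \<Rightarrow> real" and \<sigma>2 :: real
  assumes L: "Legendre \<psi>" and Lc: "Legendre (fenchel_conjugate \<psi>)"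
    and obs: "B \<subseteq> effdom (fenchel_conjugate \<psi>)"
    and op: "open (effdom \<psi>)" and pos: "0 < \<sigma>2"
    and id[measurable]: "(\<lambda>b. b) \<in> borel_measurable \<nu>"
    and B: "B \<in> sets \<nu>"
    and base: "base_measure \<nu> B (\<lambda>b. p0 b \<sigma>2)"
    and mass: "\<And>\<theta>. \<theta> \<in> effdom \<psi> \<Longrightarrow> (LINT b:B|\<nu>. p_dens \<psi> p0 b \<theta> \<sigma>2) = 1"
begin

definition dispersion_base :: "'a \<Rightarrow> real \<Rightarrow> real" where
  "dispersion_base b s = exp (- fin (fenchel_conjugate \<psi>) b / s) * p0 b s"

lemma proper: "proper_fun \<psi>" "proper_fun (fenchel_conjugate \<psi>)"
  using L Lc by (auto simp: Legendre_def)

lemma int_dom: "interior (effdom \<psi>) = effdom \<psi>"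
  using op by (rule interior_open)

lemma p_dens_eq:
  assumes \<theta>: "\<theta> \<in> effdom \<psi>" and b: "b \<in> B"
  shows "p_dens \<psi> p0 b \<theta> \<sigma>2 = exp ((b \<bullet> \<theta> - fin \<psi> \<theta>) / \<sigma>2) * dispersion_base b \<sigma>2"
proof -
  have "b \<in> effdom (fenchel_conjugate \<psi>)" using b obs by blast
  then have "divergence \<psi> b \<theta> / ereal \<sigma>2
      = ereal ((fin (fenchel_conjugate \<psi>) b + fin \<psi> \<theta> - b \<bullet> \<theta>) / \<sigma>2)"
    using pos \<theta> by (simp add: divergence_def proper_fun_eq_ereal_fin proper)
  then show ?thesis
    unfolding p_dens_def exp_neg_def dispersion_base_def
    by (simp add: mult_exp_exp diff_divide_distrib add_divide_distrib flip: mult.assoc)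
qed

lemma p_dens_nonneg: "b \<in> B \<Longrightarrow> 0 \<le> p_dens \<psi> p0 b \<theta> \<sigma>2"
  using base by (simp add: p_dens_def exp_neg_def base_measure_def)

text \<open>A function that is not integrable has Bochner integral \<open>0\<close>, so mass one entails integrability.\<close>

lemma p_dens_integrable:
  "\<theta> \<in> effdom \<psi> \<Longrightarrow> set_integrable \<nu> B (\<lambda>b. p_dens \<psi> p0 b \<theta> \<sigma>2)"
  using mass[of \<theta>] not_integrable_integral_eq
  unfolding set_integrable_def set_lebesgue_integral_def by force

text \<open>Measurability comes from the family itself: the weight is an integrable density multiplied by the
  inverse of its continuous exponential factor.\<close>

lemma base_measure_dispersion_base: "base_measure \<nu> B (\<lambda>b. dispersion_base b \<sigma>2)"
proof -
  obtain \<theta> where \<theta>: "\<theta> \<in> effdom \<psi>" using proper(1) by (auto simp: proper_fun_def)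
  have [measurable]: "(\<lambda>b. indicator B b *\<^sub>R p_dens \<psi> p0 b \<theta> \<sigma>2) \<in> borel_measurable \<nu>"
    using p_dens_integrable[OF \<theta>] unfolding set_integrable_def by (rule borel_measurable_integrable)
  have "(\<lambda>b. exp (- ((b \<bullet> \<theta> - fin \<psi> \<theta>) / \<sigma>2)) * (indicator B b *\<^sub>R p_dens \<psi> p0 b \<theta> \<sigma>2))
      \<in> borel_measurable \<nu>"
    by measurable
  also have "(\<lambda>b. exp (- ((b \<bullet> \<theta> - fin \<psi> \<theta>) / \<sigma>2)) * (indicator B b *\<^sub>R p_dens \<psi> p0 b \<theta> \<sigma>2))
      = (\<lambda>b. indicator B b *\<^sub>R dispersion_base b \<sigma>2)"
    by (auto simp: p_dens_eq[OF \<theta>] exp_minus fun_eq_iff split: split_indicator)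
  finally show ?thesis
    using base unfolding base_measure_def set_borel_measurable_def dispersion_base_def by simp
qed

text \<open>The family is closed under exponential tilting; this is the identity from which all statements about
  cumulants follow.\<close>

lemma exp_tilt_p_dens:
  assumes \<theta>: "\<theta> \<in> effdom \<psi>" and x: "\<theta> + \<sigma>2 *\<^sub>R x \<in> effdom \<psi>" and b: "b \<in> B"
  shows "exp (x \<bullet> b) * p_dens \<psi> p0 b \<theta> \<sigma>2
    = exp (K_fun \<psi> \<theta> \<sigma>2 x) * p_dens \<psi> p0 b (\<theta> + \<sigma>2 *\<^sub>R x) \<sigma>2"
proof -
  have "x \<bullet> b + (b \<bullet> \<theta> - fin \<psi> \<theta>) / \<sigma>2
      = K_fun \<psi> \<theta> \<sigma>2 x + (b \<bullet> (\<theta> + \<sigma>2 *\<^sub>R x) - fin \<psi> (\<theta> + \<sigma>2 *\<^sub>R x)) / \<sigma>2"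
    using pos by (simp add: K_fun_def inner_add_right inner_commute field_simps)
  then show ?thesis
    by (simp add: p_dens_eq \<theta> x b mult_exp_exp flip: mult.assoc)
qed

lemma mgf_p_dens:
  assumes \<theta>: "\<theta> \<in> effdom \<psi>" and x: "\<theta> + \<sigma>2 *\<^sub>R x \<in> effdom \<psi>"
  shows "set_integrable \<nu> B (\<lambda>b. exp (x \<bullet> b) * p_dens \<psi> p0 b \<theta> \<sigma>2)"
    and "(LINT b:B|\<nu>. exp (x \<bullet> b) * p_dens \<psi> p0 b \<theta> \<sigma>2) = exp (K_fun \<psi> \<theta> \<sigma>2 x)"
proof -
  have "set_integrable \<nu> B (\<lambda>b. exp (K_fun \<psi> \<theta> \<sigma>2 x) * p_dens \<psi> p0 b (\<theta> + \<sigma>2 *\<^sub>R x) \<sigma>2)"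
    using p_dens_integrable[OF x] by simp
  then show "set_integrable \<nu> B (\<lambda>b. exp (x \<bullet> b) * p_dens \<psi> p0 b \<theta> \<sigma>2)"
    by (subst set_integrable_cong[OF refl refl exp_tilt_p_dens[OF \<theta> x]])
  have "(LINT b:B|\<nu>. exp (x \<bullet> b) * p_dens \<psi> p0 b \<theta> \<sigma>2)
      = (LINT b:B|\<nu>. exp (K_fun \<psi> \<theta> \<sigma>2 x) * p_dens \<psi> p0 b (\<theta> + \<sigma>2 *\<^sub>R x) \<sigma>2)"
    using B exp_tilt_p_dens[OF \<theta> x] by (intro set_lebesgue_integral_cong) auto
  also have "\<dots> = exp (K_fun \<psi> \<theta> \<sigma>2 x)" using mass[OF x] by simp
  finally show "(LINT b:B|\<nu>. exp (x \<bullet> b) * p_dens \<psi> p0 b \<theta> \<sigma>2) = exp (K_fun \<psi> \<theta> \<sigma>2 x)" .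
qed

lemma GDERIV_K_fun:
  assumes \<theta>: "\<theta> \<in> effdom \<psi>"
  shows "GDERIV (K_fun \<psi> \<theta> \<sigma>2) 0 :> grad (fin \<psi>) \<theta>"
proof -
  have "(fin \<psi> has_derivative (\<lambda>h. h \<bullet> grad (fin \<psi>) \<theta>)) (at (\<theta> + \<sigma>2 *\<^sub>R 0))"
    using Legendre_GDERIV[OF L] \<theta> int_dom by (simp add: gderiv_def)
  moreover have "((\<lambda>x. \<theta> + \<sigma>2 *\<^sub>R x) has_derivative (\<lambda>h. \<sigma>2 *\<^sub>R h)) (at 0)"
    by (auto intro!: derivative_eq_intros)
  ultimately have "((\<lambda>x. fin \<psi> (\<theta> + \<sigma>2 *\<^sub>R x)) has_derivative (\<lambda>h. (\<sigma>2 *\<^sub>R h) \<bullet> grad (fin \<psi>) \<theta>)) (at 0)"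
    using has_derivative_compose by blast
  then have "((\<lambda>x. (fin \<psi> (\<theta> + \<sigma>2 *\<^sub>R x) - fin \<psi> \<theta>) / \<sigma>2) has_derivative (\<lambda>h. h \<bullet> grad (fin \<psi>) \<theta>)) (at 0)"
    using pos by (auto intro!: derivative_eq_intros)
  then show ?thesis unfolding gderiv_def K_fun_def .
qed

lemma ball_shift:
  assumes \<theta>: "\<theta> \<in> effdom \<psi>"
  obtains d where "0 < d" "\<And>x. norm x < d \<Longrightarrow> \<theta> + \<sigma>2 *\<^sub>R x \<in> effdom \<psi>"
proof -
  obtain e where e: "0 < e" "ball \<theta> e \<subseteq> effdom \<psi>" using op \<theta> open_contains_ball by blast
  show ?thesis
  proof
    show "0 < e / \<sigma>2" using e pos by simp
    show "\<theta> + \<sigma>2 *\<^sub>R x \<in> effdom \<psi>" if "norm x < e / \<sigma>2" for x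
      using that pos by (intro subsetD[OF e(2)]) (simp add: dist_norm field_simps)
  qed
qed

lemma GDERIV_cgf:
  assumes \<theta>: "\<theta> \<in> effdom \<psi>"
  shows "GDERIV (cgf \<nu> B (\<lambda>b. p_dens \<psi> p0 b \<theta> \<sigma>2)) 0 :> grad (fin \<psi>) \<theta>"
proof -
  obtain d where d: "0 < d" "\<And>x. norm x < d \<Longrightarrow> \<theta> + \<sigma>2 *\<^sub>R x \<in> effdom \<psi>"
    using ball_shift[OF \<theta>] by metis
  show ?thesis unfolding gderiv_def
    by (rule has_derivative_transform_within_open[OF GDERIV_K_fun[OF \<theta>, unfolded gderiv_def] open_ball[of 0 d]])
       (use d mgf_p_dens(2)[OF \<theta>] in \<open>auto simp: cgf_def\<close>)
qed

lemma has_mean_p_dens: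
  assumes \<theta>: "\<theta> \<in> effdom \<psi>"
  shows "has_mean \<nu> B (\<lambda>b. p_dens \<psi> p0 b \<theta> \<sigma>2) (grad (fin \<psi>) \<theta>)"
proof -
  obtain d where d: "0 < d" "\<And>x. norm x < d \<Longrightarrow> \<theta> + \<sigma>2 *\<^sub>R x \<in> effdom \<psi>"
    using ball_shift[OF \<theta>] by metis
  have "GDERIV (\<lambda>x. exp (K_fun \<psi> \<theta> \<sigma>2 x)) 0 :> exp (K_fun \<psi> \<theta> \<sigma>2 0) *\<^sub>R grad (fin \<psi>) \<theta>"
    using GDERIV_K_fun[OF \<theta>] DERIV_exp by (rule GDERIV_DERIV_compose)
  then have E: "((\<lambda>x. exp (K_fun \<psi> \<theta> \<sigma>2 x)) has_derivative (\<lambda>h. h \<bullet> grad (fin \<psi>) \<theta>)) (at 0)"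
    by (simp add: gderiv_def K_fun_def)
  show ?thesis
  proof (rule has_mean_of_mgf_GDERIV[OF id p_dens_nonneg d(1)])
    show "GDERIV (\<lambda>x. LINT b:B|\<nu>. exp (x \<bullet> b) * p_dens \<psi> p0 b \<theta> \<sigma>2) 0 :> grad (fin \<psi>) \<theta>"
      unfolding gderiv_def
      by (rule has_derivative_transform_within_open[OF E open_ball[of 0 d]])
         (use d mgf_p_dens(2)[OF \<theta>] in auto)
  qed (use d mgf_p_dens(1)[OF \<theta>] in auto)
qed

text \<open>Order zero says that the total mass is one, order one that the two gradients at \<open>0\<close> coincide.\<close>

lemma cumulants_upto_1:
  assumes \<theta>: "\<theta> \<in> effdom \<psi>" and len: "length is \<le> 1"
  shows "iter_partial is (cgf \<nu> B (\<lambda>b. p_dens \<psi> p0 b \<theta> \<sigma>2)) 0 = iter_partial is (K_fun \<psi> \<theta> \<sigma>2) 0"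
proof (cases "is")
  case Nil
  then show ?thesis using mgf_p_dens(2)[OF \<theta>, of 0] \<theta> by (simp add: cgf_def)
next
  case (Cons i js)
  then show ?thesis
    using len frechet_derivative_at[OF GDERIV_cgf[OF \<theta>, unfolded gderiv_def]]
      frechet_derivative_at[OF GDERIV_K_fun[OF \<theta>, unfolded gderiv_def]]
    by simp
qed

lemma log_concave_p_dens: "parameterized_log_concave_density \<nu> B p0 (effdom \<psi>) \<sigma>2 (p_dens \<psi> p0)"
  unfolding parameterized_log_concave_density_def
proof (intro conjI ballI base mass)
  fix \<theta> assume \<theta>: "\<theta> \<in> effdom \<psi>"
  have "Legendre (\<lambda>b. divergence \<psi> b \<theta> / ereal \<sigma>2)"
    using Legendre_tilt[OF Lc pos, of "fin \<psi> \<theta>" \<theta>]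
    by (simp add: divergence_def proper_fun_eq_ereal_fin[OF proper(1) \<theta>])
  then show "\<exists>f. Legendre f \<and> (\<forall>b. p_dens \<psi> p0 b \<theta> \<sigma>2 = exp_neg (f b) * p0 b \<sigma>2)"
    unfolding p_dens_def by blast
qed

lemma K_LED_1_p_dens:
  assumes "observation_set \<psi> B"
  shows "K_LED 1 \<nu> B \<psi> \<sigma>2 (p_dens \<psi> p0)"
  unfolding K_LED_def int_dom
proof (intro conjI)
  show "Ck_on 1 (fin \<psi>) (effdom \<psi>)" using L by (simp add: Legendre_def int_dom)
  show "\<exists>p1. base_measure \<nu> B (\<lambda>b. p1 b \<sigma>2) \<and> (\<forall>\<theta>\<in>effdom \<psi>. \<forall>b\<in>B.
      p_dens \<psi> p0 b \<theta> \<sigma>2 = exp ((b \<bullet> \<theta> - fin \<psi> \<theta>) / \<sigma>2) * p1 b \<sigma>2)"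
    by (intro exI[of _ dispersion_base] conjI ballI base_measure_dispersion_base p_dens_eq)
  show "\<forall>\<theta>\<in>effdom \<psi>. (LINT b:B|\<nu>. p_dens \<psi> p0 b \<theta> \<sigma>2) = 1"
    by (intro ballI mass)
  show "\<forall>\<theta>\<in>effdom \<psi>. has_mean \<nu> B (\<lambda>b. p_dens \<psi> p0 b \<theta> \<sigma>2) (grad (fin \<psi>) \<theta>)"
    by (intro ballI has_mean_p_dens)
  show "\<forall>\<theta>\<in>effdom \<psi>. \<forall>is. set is \<subseteq> Basis \<and> length is \<le> 1 \<longrightarrow>
      iter_partial is (cgf \<nu> B (\<lambda>b. p_dens \<psi> p0 b \<theta> \<sigma>2)) 0 = iter_partial is (K_fun \<psi> \<theta> \<sigma>2) 0"
    by (intro ballI allI impI cumulants_upto_1) auto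
qed (rule L pos assms order_refl)+

end

theorem mainTheorem1:
  fixes \<psi> :: "real ^ 'n \<Rightarrow> ereal"
    and B :: "(real ^ 'n) set"
    and \<nu> :: "(real ^ 'n) measure"
    and p0 :: "real ^ 'n \<Rightarrow> real \<Rightarrow> real"
    and \<sigma>2 :: real
  assumes "Legendre \<psi>"
    and "Legendre (fenchel_conjugate \<psi>)"
    and "observation_set \<psi> B"
    and "open (effdom (fenchel_conjugate \<psi>))"
    and "open (effdom \<psi>)"
    and "0 < \<sigma>2"
    and "lebesgue_or_counting \<nu>"
    and "B \<in> sets \<nu>"
    and "base_measure \<nu> B (\<lambda>b. p0 b \<sigma>2)"
    and "\<forall>\<theta>\<in>effdom \<psi>. (LINT b:B|\<nu>. p_dens \<psi> p0 b \<theta> \<sigma>2) = 1"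
  shows "parameterized_log_concave_density \<nu> B p0 (effdom \<psi>) \<sigma>2 (p_dens \<psi> p0) \<and>
         (\<forall>\<theta>\<in>effdom \<psi>.
            (GDERIV (cgf \<nu> B (\<lambda>b. p_dens \<psi> p0 b \<theta> \<sigma>2)) 0 :> grad (fin \<psi>) \<theta>) \<and>
            has_mean \<nu> B (\<lambda>b. p_dens \<psi> p0 b \<theta> \<sigma>2) (grad (fin \<psi>) \<theta>) \<and>
            grad (fin \<psi>) \<theta> \<in> effdom (fenchel_conjugate \<psi>)) \<and>
         K_LED 1 \<nu> B \<psi> \<sigma>2 (p_dens \<psi> p0)"
proof -
  note A = assms
  have obs: "B \<subseteq> effdom (fenchel_conjugate \<psi>)" using A(3) by (simp add: observation_set_def)
  have lebesgue: "(\<lambda>b. b) \<in> borel_measurable (lebesgue :: (real ^ 'n) measure)"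
    by (rule measurable_completion) measurable
  have id: "(\<lambda>b. b) \<in> borel_measurable \<nu>"
    using A(7) unfolding lebesgue_or_counting_def
  proof
    assume \<nu>: "\<nu> = lebesgue"
    show ?thesis unfolding \<nu> by (rule lebesgue)
  next
    assume \<nu>: "\<nu> = count_space UNIV"
    show ?thesis unfolding \<nu> by simp
  qed
  have mass: "(LINT b:B|\<nu>. p_dens \<psi> p0 b \<theta> \<sigma>2) = 1" if "\<theta> \<in> effdom \<psi>" for \<theta>
    using A(10) that by blast
  note ctxt = A(1,2) obs A(5,6) id A(8,9) mass
  show ?thesis
  proof (intro conjI ballI)
    show "parameterized_log_concave_density \<nu> B p0 (effdom \<psi>) \<sigma>2 (p_dens \<psi> p0)"
      by (rule log_concave_p_dens[OF ctxt])
    show "K_LED 1 \<nu> B \<psi> \<sigma>2 (p_dens \<psi> p0)"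
      by (rule K_LED_1_p_dens[OF ctxt A(3)])
    fix \<theta> assume \<theta>: "\<theta> \<in> effdom \<psi>"
    show "GDERIV (cgf \<nu> B (\<lambda>b. p_dens \<psi> p0 b \<theta> \<sigma>2)) 0 :> grad (fin \<psi>) \<theta>"
      by (rule GDERIV_cgf[OF ctxt \<theta>])
    show "has_mean \<nu> B (\<lambda>b. p_dens \<psi> p0 b \<theta> \<sigma>2) (grad (fin \<psi>) \<theta>)"
      by (rule has_mean_p_dens[OF ctxt \<theta>])
    show "grad (fin \<psi>) \<theta> \<in> effdom (fenchel_conjugate \<psi>)"
      by (rule Legendre_grad_in_effdom_conjugate[OF A(1)]) (use \<theta> in \<open>simp only: interior_open[OF A(5)]\<close>)
  qed
qed

end
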